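(* Let $X$ be a Banach space and, for each $\eta\in[0,1]$, let $T_\eta\in C(X)$ and let $\mathcal{E}_\eta$ be the set of equilibrium points of $T_\eta$. Suppose that every point of $\mathcal E_0$ is a weakly hyperbolic point of $T_0$. Assume that $\mathcal{E}_0$ is finite, that $\bigcup_{\eta\in[0,1]}\mathcal{E}_\eta$ is precompact in $X$, and that $|\!|\!|T_\eta-T_0|\!|\!|_V\to 0$ as $\eta\to0^+$ for some neighborhood $V$ of $\overline{\bigcup_{\eta\in[0,1]}\mathcal{E}_\eta}$. Then there exists $\eta_0>0$ such that $\mathcal{E}_\eta$ is finite and possesses the same number of elements as $\mathcal{E}_0$ for each $0\leqslant\eta\leqslant\eta_0$.
   Context: $C(X)$ is the set of continuous maps $X\to X$; an equilibrium point of $T$ is $x$ with $T(x)=x$. For a map $T$ defined on $V\subset X$: $\|T\|_{V,Lip}=\sup_{x\ne y\in V}\frac{\|T(x)-T(y)\|}{\|x-y\|}$, $\|T\|_{V,\infty}=\sup_{x\in V}\|T(x)\|$ and $|\!|\!|T|\!|\!|_V=\max\{\|T\|_{V,\infty},\|T\|_{V,Lip}\}$. Weakly hyperbolic points. Let $L$ be a bounded linear operator on $X$ with $\sigma(L)\cap\{|\lambda|=1\}=\varnothing$. Put $\pi_s=\frac1{2\pi i}\int_{|\lambda|=1}(\lambda-L)^{-1}d\lambda$, $\pi_u=I-\pi_s$, $X_j=\pi_jX$, $L_j=L|_{X_j}$ ($j=u,s$). One has $0<b<1<a$ with $\sigma(L_s)\subset\{|\lambda|<b\}$, $\sigma(L_u)\subset\{|\lambda|>a\}$,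 and $X$ is equipped with an equivalent norm satisfying $\|L_s\|\leqslant b$, $\|L_u^{-1}\|\leqslant a^{-1}$, $\|x_u+x_s\|=\max\{\|x_u\|,\|x_s\|\}$. An equilibrium point $x^\ast$ of $T$ is weakly hyperbolic if $S(x)=T(x+x^\ast)-x^\ast$ has a decomposition $S=L+N$ with: (i) $L,a,b$ and the norm as just described; (ii) there are a neighborhood $U_0$ of $0$ and $\gamma={\rm Lip}(N)>0$ with $b+2\gamma<1<a-2\gamma$ and $\|N(x)-N(y)\|\leqslant\gamma\|x-y\|$ on $U_0$; (iii) $0<\gamma\|(I-L)^{-1}\|\leqslant1$. *)

theory Defs
  imports "HOL-Analysis.Analysis"
begin

text \<open>
  The ambient space is a type of class \<open>banach\<close>, i.e. a real Banach space. To treat real and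
  complex Banach spaces together, the scalar field is recorded separately: a complex structure is
  given by the operator \<open>J\<close> of multiplication by the imaginary unit. Over the reals, spectra and
  spectral projections are those of the complexification \<open>'a \<times> 'a\<close>, where \<open>(x, y)\<close>
  stands for \<open>x + \<i> y\<close>.
\<close>

datatype 'a scalars = Real_Scalars | Complex_Scalars "'a \<Rightarrow> 'a"

definition cscale :: "('b::real_vector \<Rightarrow> 'b) \<Rightarrow> complex \<Rightarrow> 'b \<Rightarrow> 'b" where
  "cscale J c x = Re c *\<^sub>R x + Im c *\<^sub>R J x"

definition complexification_J :: "'a::real_vector \<times> 'a \<Rightarrow> 'a \<times> 'a" where
  "complexification_J = (\<lambda>(x, y). (- y, x))"

fun banach_scalars :: "'a::banach scalars \<Rightarrow> bool" where
  "banach_scalars Real_Scalars \<longleftrightarrow> True"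
| "banach_scalars (Complex_Scalars J) \<longleftrightarrow>
     linear J \<and> (\<forall>x. J (J x) = - x) \<and> (\<forall>c x. norm (cscale J c x) = cmod c * norm x)"

fun bounded_operator :: "'a::banach scalars \<Rightarrow> ('a \<Rightarrow> 'a) \<Rightarrow> bool" where
  "bounded_operator Real_Scalars L \<longleftrightarrow> bounded_linear L"
| "bounded_operator (Complex_Scalars J) L \<longleftrightarrow> bounded_linear L \<and> (\<forall>x. L (J x) = J (L x))"

fun homogeneous :: "'a::banach scalars \<Rightarrow> ('a \<Rightarrow> real) \<Rightarrow> bool" where
  "homogeneous Real_Scalars \<nu> \<longleftrightarrow> (\<forall>r x. \<nu> (r *\<^sub>R x) = \<bar>r\<bar> * \<nu> x)"
| "homogeneous (Complex_Scalars J) \<nu> \<longleftrightarrow> (\<forall>c x. \<nu> (cscale J c x) = cmod c * \<nu> x)"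

definition equivalent_norm :: "'a::banach scalars \<Rightarrow> ('a \<Rightarrow> real) \<Rightarrow> bool" where
  "equivalent_norm K \<nu> \<longleftrightarrow>
     homogeneous K \<nu> \<and> (\<forall>x y. \<nu> (x + y) \<le> \<nu> x + \<nu> y) \<and>
     (\<exists>c>0. \<exists>C. \<forall>x. c * norm x \<le> \<nu> x \<and> \<nu> x \<le> C * norm x)"

text \<open>
  The norm with respect to \<open>\<nu>\<close> of an operator on the subspace \<open>Y\<close>; as in \<open>onorm\<close>, the vector
  \<open>0\<close> contributes \<open>0 / 0 = 0\<close>.
\<close>

definition opnorm_on :: "('a::banach \<Rightarrow> real) \<Rightarrow> 'a set \<Rightarrow> ('a \<Rightarrow> 'a) \<Rightarrow> ennreal" where
  "opnorm_on \<nu> Y A = (SUP x\<in>Y. ennreal (\<nu> (A x) / \<nu> x))"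

text \<open>Resolvent and spectrum of the operator that \<open>A\<close> induces on the subspace \<open>Y\<close>.\<close>

definition resolvent_on ::
  "('b::banach \<Rightarrow> 'b) \<Rightarrow> 'b set \<Rightarrow> ('b \<Rightarrow> 'b) \<Rightarrow> complex \<Rightarrow> 'b \<Rightarrow> 'b" where
  "resolvent_on J Y A c = inv_into Y (\<lambda>x. cscale J c x - A x)"

definition spectrum_on ::
  "('b::banach \<Rightarrow> 'b) \<Rightarrow> 'b set \<Rightarrow> ('b \<Rightarrow> 'b) \<Rightarrow> complex set" where
  "spectrum_on J Y A =
     - {c. bij_betw (\<lambda>x. cscale J c x - A x) Y Y \<and>
           (\<exists>M. \<forall>y\<in>Y. norm (resolvent_on J Y A c y) \<le> M * norm y)}"

text \<open>
  The contour integral over the positively oriented unit circle, parametrized by \<open>cis\<close>, and the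
  projection \<open>(1 / 2\<pi>\<i>) \<integral> (c - A)\<^sup>-\<^sup>1 x dc\<close>.
\<close>

definition circle_integral :: "('b::banach \<Rightarrow> 'b) \<Rightarrow> (complex \<Rightarrow> 'b) \<Rightarrow> 'b" where
  "circle_integral J f = integral {0..2 * pi} (\<lambda>t. cscale J (\<i> * cis t) (f (cis t)))"

definition riesz_projection :: "('b::banach \<Rightarrow> 'b) \<Rightarrow> ('b \<Rightarrow> 'b) \<Rightarrow> 'b \<Rightarrow> 'b" where
  "riesz_projection J A x =
     cscale J (1 / (2 * complex_of_real pi * \<i>))
       (circle_integral J (\<lambda>c. resolvent_on J UNIV A c x))"

fun spec :: "'a::banach scalars \<Rightarrow> 'a set \<Rightarrow> ('a \<Rightarrow> 'a) \<Rightarrow> complex set" where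
  "spec Real_Scalars Y A = spectrum_on complexification_J (Y \<times> Y) (map_prod A A)"
| "spec (Complex_Scalars J) Y A = spectrum_on J Y A"

text \<open>
  Over the reals the projection of the complexification is the complexification of a projection
  of the space itself, which is recovered by restricting to the real vectors \<open>(x, 0)\<close>.
\<close>

fun proj_s :: "'a::banach scalars \<Rightarrow> ('a \<Rightarrow> 'a) \<Rightarrow> 'a \<Rightarrow> 'a" where
  "proj_s Real_Scalars A x = fst (riesz_projection complexification_J (map_prod A A) (x, 0))"
| "proj_s (Complex_Scalars J) A x = riesz_projection J A x"

definition proj_u :: "'a::banach scalars \<Rightarrow> ('a \<Rightarrow> 'a) \<Rightarrow> 'a \<Rightarrow> 'a" where
  "proj_u K A x = x - proj_s K A x"

definition hyperbolic_splitting ::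
  "'a::banach scalars \<Rightarrow> ('a \<Rightarrow> 'a) \<Rightarrow> real \<Rightarrow> real \<Rightarrow> ('a \<Rightarrow> real) \<Rightarrow> bool" where
  "hyperbolic_splitting K L a b \<nu> \<longleftrightarrow>
     (let Xs = range (proj_s K L); Xu = range (proj_u K L) in
        bounded_operator K L \<and>
        spec K UNIV L \<inter> {c. cmod c = 1} = {} \<and>
        0 < b \<and> b < 1 \<and> 1 < a \<and>
        spec K Xs L \<subseteq> {c. cmod c < b} \<and>
        spec K Xu L \<subseteq> {c. cmod c > a} \<and>
        equivalent_norm K \<nu> \<and>
        opnorm_on \<nu> Xs L \<le> ennreal b \<and>
        opnorm_on \<nu> Xu (inv_into Xu L) \<le> ennreal (inverse a) \<and>
        (\<forall>xu\<in>Xu. \<forall>xs\<in>Xs. \<nu> (xu + xs) = max (\<nu> xu) (\<nu> xs)))"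

definition equilibria :: "('a \<Rightarrow> 'a) \<Rightarrow> 'a set" where
  "equilibria T = {x. T x = x}"

text \<open>
  The number \<open>\<gamma>\<close> is only required to be some Lipschitz constant of \<open>N\<close> on \<open>U\<close>, not the least
  one. All norms here are the adapted norm \<open>\<nu>\<close>, which may differ from point to point.
\<close>

definition weakly_hyperbolic :: "'a::banach scalars \<Rightarrow> ('a \<Rightarrow> 'a) \<Rightarrow> 'a \<Rightarrow> bool" where
  "weakly_hyperbolic K T p \<longleftrightarrow>
     p \<in> equilibria T \<and>
     (\<exists>L N a b \<nu> U \<gamma>.
        (\<forall>x. T (x + p) - p = L x + N x) \<and>
        hyperbolic_splitting K L a b \<nu> \<and>
        0 \<in> interior U \<and>
        0 < \<gamma> \<and> b + 2 * \<gamma> < 1 \<and> 1 < a - 2 * \<gamma> \<and>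
        (\<forall>x\<in>U. \<forall>y\<in>U. \<nu> (N x - N y) \<le> \<gamma> * \<nu> (x - y)) \<and>
        0 < ennreal \<gamma> * opnorm_on \<nu> UNIV (inv (\<lambda>x. x - L x)) \<and>
        ennreal \<gamma> * opnorm_on \<nu> UNIV (inv (\<lambda>x. x - L x)) \<le> 1)"

definition sup_norm_on :: "'a::banach set \<Rightarrow> ('a \<Rightarrow> 'a) \<Rightarrow> ennreal" where
  "sup_norm_on V T = (SUP x\<in>V. ennreal (norm (T x)))"

definition lip_norm_on :: "'a::banach set \<Rightarrow> ('a \<Rightarrow> 'a) \<Rightarrow> ennreal" where
  "lip_norm_on V T =
     (SUP (x, y)\<in>{(x, y). x \<in> V \<and> y \<in> V \<and> x \<noteq> y}. ennreal (norm (T x - T y) / norm (x - y)))"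

definition triple_norm_on :: "'a::banach set \<Rightarrow> ('a \<Rightarrow> 'a) \<Rightarrow> ennreal" where
  "triple_norm_on V T = max (sup_norm_on V T) (lip_norm_on V T)"

end

theory Submission
  imports Defs
begin

text \<open>
  Near an equilibrium \<open>p\<close> of \<open>T\<close>, write \<open>x = p + h\<close>, \<open>T (p + h) = p + L h + N h\<close> and
  \<open>R = S - T\<close>. Then \<open>x\<close> is a fixed point of \<open>S\<close> exactly when
  \<open>h = (I - L)\<^sup>-\<^sup>1 (N h + R (p + h))\<close>. The point of the proof is that the right-hand side is a
  contraction. In the adapted norm, \<open>I - L\<close> shrinks no stable vector by a factor less than \<open>1 - b\<close>
  and no unstable vector by a factor less than \<open>a - 1\<close>, both parts are mapped into themselves, and
  the norm of a vector is the maximum of the norms of its parts. Hence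
  \<open>\<parallel>(I - L)\<^sup>-\<^sup>1\<parallel> \<le> 1 / m\<close> with \<open>m = min (1 - b) (a - 1) > 2 * \<gamma>\<close>
  (lemma \<open>hyperbolic_splitting_bounded_below\<close>), so \<open>(I - L)\<^sup>-\<^sup>1 N\<close> has Lipschitz constant below
  \<open>1/2\<close>, and a perturbation \<open>R\<close> that is small together with its Lipschitz constant adds at
  most \<open>1/4\<close> to it and moves the centre of a small ball only little. Banach's theorem then yields exactly one
  fixed point of \<open>S\<close> in a neighbourhood of \<open>p\<close> (lemma \<open>weakly_hyperbolic_persists\<close>).

  The two parts of a vector exist because \<open>proj_u\<close> is defined as identity minus \<open>proj_s\<close>. That
  \<open>I - L\<close> maps each range onto itself is encoded in the statement that \<open>1\<close> avoids the spectrum of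
  the restriction. In the same way \<open>0\<close> avoids the spectrum on the unstable range, so \<open>- L\<close> maps this
  range onto itself; the range is symmetric because the projection is odd, so \<open>L\<close> does too.

  To count, choose disjoint neighbourhoods of this kind around the finitely many equilibria of \<open>T 0\<close>.
  On the compact closure of all equilibria minus the interiors of these neighbourhoods the continuous
  function \<open>norm (x - T 0 x)\<close> is bounded away from \<open>0\<close>, so for small \<open>\<eta>\<close> no equilibrium of
  \<open>T \<eta>\<close> lies there, and there is exactly one in each neighbourhood.
\<close>

section \<open>Equivalent norms and contractions\<close>

lemma equivalent_norm_bounds:
  assumes "equivalent_norm K \<nu>"
  obtains c C where "0 < c" "0 < C" "\<And>x. c * norm x \<le> \<nu> x" "\<And>x. \<nu> x \<le> C * norm x"
proof -
  obtain c C where c: "0 < c" "\<forall>x. c * norm x \<le> \<nu> x \<and> \<nu> x \<le> C * norm x"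
    using assms unfolding equivalent_norm_def by blast
  then have "\<nu> x \<le> max 1 C * norm x" for x
    by (meson max.cobounded2 mult_right_mono norm_ge_zero order_trans)
  then show thesis
    using c by (intro that[of c "max 1 C"]) auto
qed

lemma equivalent_norm_triangle:
  "equivalent_norm K \<nu> \<Longrightarrow> \<nu> (x + y) \<le> \<nu> x + \<nu> y"
  by (auto simp: equivalent_norm_def)

lemma equivalent_norm_minus:
  assumes "equivalent_norm K \<nu>"
  shows "\<nu> (- x) = \<nu> x"
proof (cases K)
  case Real_Scalars
  then have "\<forall>r x. \<nu> (r *\<^sub>R x) = \<bar>r\<bar> * \<nu> x"
    using assms by (simp add: equivalent_norm_def)
  then have "\<nu> ((-1) *\<^sub>R x) = \<bar>-1\<bar> * \<nu> x" by blast
  then show ?thesis by simp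
next
  case (Complex_Scalars J)
  then have "\<nu> (cscale J (-1) x) = cmod (-1) * \<nu> x"
    using assms unfolding equivalent_norm_def by simp
  then show ?thesis by (simp add: cscale_def)
qed

lemma equivalent_norm_minus_commute:
  "equivalent_norm K \<nu> \<Longrightarrow> \<nu> (x - y) = \<nu> (y - x)"
  using equivalent_norm_minus[of K \<nu> "x - y"] by simp

lemma equivalent_norm_diff_triangle:
  "equivalent_norm K \<nu> \<Longrightarrow> \<nu> x - \<nu> y \<le> \<nu> (x - y)"
  using equivalent_norm_triangle[of K \<nu> "x - y" y] by simp

lemma equivalent_norm_nonneg:
  assumes "equivalent_norm K \<nu>"
  shows "0 \<le> \<nu> x"
proof -
  obtain c C where "0 < c" "c * norm x \<le> \<nu> x"
    using equivalent_norm_bounds[OF assms] by metis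
  moreover have "0 \<le> c * norm x" using \<open>0 < c\<close> by simp
  ultimately show ?thesis by linarith
qed

lemma equivalent_norm_eq_0_iff:
  assumes "equivalent_norm K \<nu>"
  shows "\<nu> x = 0 \<longleftrightarrow> x = 0"
proof -
  obtain c C where "0 < c" "c * norm x \<le> \<nu> x" "\<nu> x \<le> C * norm x"
    using equivalent_norm_bounds[OF assms] by metis
  then show ?thesis
    using equivalent_norm_nonneg[OF assms, of x] by (auto simp: mult_le_0_iff)
qed

lemma equivalent_norm_ball_metric:
  assumes "equivalent_norm K \<nu>"
  shows "Metric_space M (\<lambda>x y. \<nu> (x - y))"
proof
  show "0 \<le> \<nu> (x - y)" for x y by (rule equivalent_norm_nonneg[OF assms])
  show "\<nu> (x - y) = \<nu> (y - x)" for x y by (rule equivalent_norm_minus_commute[OF assms])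
  show "\<nu> (x - y) = 0 \<longleftrightarrow> x = y" for x y by (simp add: equivalent_norm_eq_0_iff[OF assms])
  show "\<nu> (x - z) \<le> \<nu> (x - y) + \<nu> (y - z)" for x y z
    using equivalent_norm_triangle[OF assms, of "x - y" "y - z"] by simp
qed

text \<open>
  The contraction below contracts in \<open>\<nu>\<close>, possibly not in the given norm, so Banach's theorem has to
  be applied to the metric of \<open>\<nu>\<close>. Cauchy sequences and limits are the same for both norms.
\<close>

lemma equivalent_norm_ball_complete:
  fixes \<nu> :: "'a::banach \<Rightarrow> real"
  assumes "equivalent_norm K \<nu>"
  shows "Metric_space.mcomplete {h. \<nu> h \<le> r} (\<lambda>x y. \<nu> (x - y))"
proof -
  interpret Metric_space "{h. \<nu> h \<le> r}" "\<lambda>x y. \<nu> (x - y)"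
    by (rule equivalent_norm_ball_metric[OF assms])
  obtain c C where c: "0 < c" "\<And>x. c * norm x \<le> \<nu> x" and C: "0 < C" "\<And>x. \<nu> x \<le> C * norm x"
    using equivalent_norm_bounds[OF assms] by metis
  show ?thesis
    unfolding mcomplete_def
  proof (intro allI impI)
    fix \<sigma> :: "nat \<Rightarrow> 'a" assume \<sigma>: "MCauchy \<sigma>"
    have "Cauchy \<sigma>"
    proof (rule CauchyI)
      fix e :: real assume "0 < e"
      then obtain N where N: "\<And>m n. N \<le> m \<Longrightarrow> N \<le> n \<Longrightarrow> \<nu> (\<sigma> m - \<sigma> n) < c * e"
        using \<sigma> c(1) unfolding MCauchy_def by (meson mult_pos_pos)
      have "norm (\<sigma> m - \<sigma> n) < e" if "N \<le> m" "N \<le> n" for m n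
      proof -
        have "c * norm (\<sigma> m - \<sigma> n) < c * e"
          using c(2)[of "\<sigma> m - \<sigma> n"] N[OF that] by linarith
        then show ?thesis using c(1) by simp
      qed
      then show "\<exists>N. \<forall>m\<ge>N. \<forall>n\<ge>N. norm (\<sigma> m - \<sigma> n) < e" by blast
    qed
    then obtain l where l: "\<sigma> \<longlonglongrightarrow> l"
      by (auto simp: Cauchy_convergent_iff convergent_def)
    have "(\<lambda>n. norm (\<sigma> n - l)) \<longlonglongrightarrow> 0"
      using l by (simp add: LIM_zero tendsto_norm_zero)
    then have null: "(\<lambda>n. C * norm (\<sigma> n - l)) \<longlonglongrightarrow> 0"
      by (rule tendsto_mult_right_zero)
    have "norm (\<nu> (\<sigma> n - l)) \<le> C * norm (\<sigma> n - l)" for n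
      using C(2)[of "\<sigma> n - l"] equivalent_norm_nonneg[OF assms, of "\<sigma> n - l"] by simp
    then have lim: "(\<lambda>n. \<nu> (\<sigma> n - l)) \<longlonglongrightarrow> 0"
      by (intro Lim_null_comparison[OF always_eventually null]) blast
    have ball: "\<nu> (\<sigma> n) \<le> r" for n
      using \<sigma> by (auto simp: MCauchy_def)
    have "\<nu> l - r \<le> \<nu> (\<sigma> n - l)" for n
      using equivalent_norm_diff_triangle[OF assms, of l "\<sigma> n"] ball[of n]
        equivalent_norm_minus_commute[OF assms, of l "\<sigma> n"] by linarith
    then have "\<nu> l - r \<le> 0"
      using lim by (intro LIMSEQ_le_const) auto
    then have "limitin mtopology \<sigma> l sequentially"
      unfolding limitin_metric using ball order_tendstoD(2)[OF lim] by auto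
    then show "\<exists>x. limitin mtopology \<sigma> x sequentially" by blast
  qed
qed

text \<open>
  A contraction that moves the centre by at most \<open>(1 - q) * r\<close> maps the ball of radius \<open>r\<close> into
  itself.
\<close>

lemma contraction_on_equivalent_norm_ball:
  fixes \<nu> :: "'a::banach \<Rightarrow> real"
  assumes "equivalent_norm K \<nu>" and q: "q < 1" and r: "0 \<le> r"
    and contr: "\<And>h k. \<nu> h \<le> r \<Longrightarrow> \<nu> k \<le> r \<Longrightarrow> \<nu> (G h - G k) \<le> q * \<nu> (h - k)"
    and q0: "0 \<le> q" and centre: "\<nu> (G 0) \<le> (1 - q) * r"
  shows "\<exists>!h. \<nu> h \<le> r \<and> G h = h"
proof -
  interpret Metric_space "{h. \<nu> h \<le> r}" "\<lambda>x y. \<nu> (x - y)"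
    by (rule equivalent_norm_ball_metric[OF assms(1)])
  have zero: "\<nu> 0 = 0" by (simp add: equivalent_norm_eq_0_iff[OF assms(1)])
  have maps: "\<nu> (G h) \<le> r" if "\<nu> h \<le> r" for h
  proof -
    have "\<nu> (G h) \<le> \<nu> (G h - G 0) + \<nu> (G 0)"
      using equivalent_norm_triangle[OF assms(1), of "G h - G 0" "G 0"] by simp
    also have "\<dots> \<le> q * \<nu> h + (1 - q) * r"
      using contr[of h 0] that zero r centre by simp
    also have "\<dots> \<le> q * r + (1 - q) * r"
      using that q0 by (simp add: mult_left_mono)
    finally show ?thesis by (simp add: algebra_simps)
  qed
  obtain h where h: "h \<in> {h. \<nu> h \<le> r}" "G h = h"
  proof (rule Banach_fixedpoint_thm)
    show "mcomplete" by (rule equivalent_norm_ball_complete[OF assms(1)])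
    show "{h. \<nu> h \<le> r} \<noteq> {}" 
    proof -
      have "0 \<in> {h. \<nu> h \<le> r}" using r zero by simp
      then show ?thesis by blast
    qed
    show "G \<in> {h. \<nu> h \<le> r} \<rightarrow> {h. \<nu> h \<le> r}" using maps by auto
    show "\<nu> (G x - G y) \<le> q * \<nu> (x - y)"
      if "x \<in> {h. \<nu> h \<le> r}" "y \<in> {h. \<nu> h \<le> r}" for x y
      using that by (auto intro: contr)
  qed (rule q)
  have "k = h" if k: "\<nu> k \<le> r" "G k = k" for k
  proof -
    have "(1 - q) * \<nu> (k - h) \<le> 0"
      using contr[of k h] h k by (simp add: algebra_simps)
    then have "\<nu> (k - h) = 0"
      using q equivalent_norm_nonneg[OF assms(1), of "k - h"] by (simp add: mult_le_0_iff)
    then show ?thesis by (simp add: equivalent_norm_eq_0_iff[OF assms(1)])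
  qed
  then show ?thesis using h by blast
qed

section \<open>The splitting bounds I - L from below\<close>

lemma cscale_of_real: "cscale J (complex_of_real c) x = c *\<^sub>R x"
  by (simp add: cscale_def)

lemma cscale_minus: "linear J \<Longrightarrow> cscale J c (- x) = - cscale J c x"
  by (simp add: cscale_def linear_neg)

lemma linear_complexification_J: "linear complexification_J"
  by (rule linearI) (auto simp: complexification_J_def)

text \<open>
  For real scalars the spectrum is that of the complexification, on which a real \<open>c\<close> acts
  componentwise; bijectivity of the product map then passes to its components.
\<close>

lemma bij_betw_if_real_not_in_spec:
  assumes "complex_of_real c \<notin> spec K Y L"
  shows "bij_betw (\<lambda>x. c *\<^sub>R x - L x) Y Y"
proof (cases K)
  case Real_Scalars
  let ?f = "\<lambda>x. c *\<^sub>R x - L x"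
  have "bij_betw (map_prod ?f ?f) (Y \<times> Y) (Y \<times> Y)"
    using assms
    by (simp add: Real_Scalars spectrum_on_def cscale_of_real map_prod_def split_def
        scaleR_prod_def minus_prod_def)
  then have "inj_on (map_prod ?f ?f) (Y \<times> Y)" and im: "?f ` Y \<times> ?f ` Y = Y \<times> Y"
    by (auto simp: bij_betw_def map_prod_surj_on)
  then have "inj_on ?f Y"
    by (auto simp: inj_on_def)
  moreover have "?f ` Y = Y"
    using im by (auto simp: times_eq_iff)
  ultimately show ?thesis by (simp add: bij_betw_def)
next
  case (Complex_Scalars J)
  then show ?thesis
    using assms by (auto simp: spectrum_on_def cscale_of_real)
qed

text \<open>
  Oddness, unlike additivity, passes through the integral whether or not the resolvent is integrable.
\<close>

lemma riesz_projection_minus: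
  assumes J: "linear J" and A: "linear A"
    and spec: "spectrum_on J UNIV A \<inter> {c. cmod c = 1} = {}"
  shows "riesz_projection J A (- x) = - riesz_projection J A x"
proof -
  have "resolvent_on J UNIV A (cis t) (- x) = - resolvent_on J UNIV A (cis t) x" for t
  proof -
    let ?f = "\<lambda>x. cscale J (cis t) x - A x"
    have "cis t \<notin> spectrum_on J UNIV A"
      using spec by auto
    then have f: "bij ?f"
      by (simp add: spectrum_on_def)
    have "?f (- inv ?f x) = - ?f (inv ?f x)"
      by (simp add: cscale_minus[OF J] linear_neg[OF A])
    also have "?f (inv ?f x) = x"
      using f by (rule surj_f_inv_f[OF bij_is_surj])
    finally show ?thesis
      unfolding resolvent_on_def using bij_inv_eq_iff[OF f, of "- inv ?f x" "- x"] by simp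
  qed
  then show ?thesis
    by (simp add: riesz_projection_def circle_integral_def cscale_minus[OF J])
qed

lemma proj_s_minus:
  assumes K: "banach_scalars K" and L: "bounded_operator K L"
    and spec: "spec K UNIV L \<inter> {c. cmod c = 1} = {}"
  shows "proj_s K L (- x) = - proj_s K L x"
proof (cases K)
  case Real_Scalars
  then have "linear L" using L by (simp add: bounded_linear.linear)
  then have "linear (map_prod L L)"
    by (intro linearI) (auto simp: linear_add linear_cmul)
  from riesz_projection_minus[OF linear_complexification_J this, of "(x, 0)"]
  show ?thesis using spec by (simp add: Real_Scalars)
next
  case (Complex_Scalars J)
  then show ?thesis
    using K L spec by (auto intro!: riesz_projection_minus bounded_linear.linear)
qed

lemma opnorm_on_leD:
  assumes \<nu>: "equivalent_norm K \<nu>" and le: "opnorm_on \<nu> Y A \<le> ennreal m" and "x \<in> Y"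
    and m: "0 \<le> m" and A0: "x = 0 \<Longrightarrow> A x = 0"
  shows "\<nu> (A x) \<le> m * \<nu> x"
proof (cases "x = 0")
  case True
  then show ?thesis using A0 equivalent_norm_eq_0_iff[OF \<nu>, of 0] by simp
next
  case False
  then have pos: "0 < \<nu> x"
    using equivalent_norm_nonneg[OF \<nu>, of x] equivalent_norm_eq_0_iff[OF \<nu>, of x] by linarith
  have "ennreal (\<nu> (A x) / \<nu> x) \<le> ennreal m"
    using le \<open>x \<in> Y\<close> unfolding opnorm_on_def by (meson SUP_upper order_trans)
  then have "\<nu> (A x) / \<nu> x \<le> m"
    using m by (simp add: ennreal_le_iff)
  then show ?thesis using pos by (simp add: field_simps)
qed

text \<open>
  On the stable part \<open>\<parallel>L\<parallel> \<le> b\<close> gives \<open>\<nu> (y - L y) \<ge> \<nu> y - \<nu> (L y) \<ge> (1 - b) \<nu> y\<close>; on the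
  unstable part \<open>\<parallel>L\<^sup>-\<^sup>1\<parallel> \<le> 1 / a\<close> gives \<open>\<nu> (y - L y) \<ge> \<nu> (L y) - \<nu> y \<ge> (a - 1) \<nu> y\<close>. Since
  \<open>I - L\<close> maps both parts into themselves, the maximum property of \<open>\<nu>\<close> applies to \<open>x\<close> and to
  \<open>x - L x\<close> alike.
\<close>

lemma hyperbolic_splitting_bounded_below:
  assumes K: "banach_scalars K" and split: "hyperbolic_splitting K L a b \<nu>"
  shows "min (1 - b) (a - 1) * \<nu> x \<le> \<nu> (x - L x)"
proof -
  define Xs where "Xs = range (proj_s K L)"
  define Xu where "Xu = range (proj_u K L)"
  have L: "bounded_operator K L" and circle: "spec K UNIV L \<inter> {c. cmod c = 1} = {}"
    and ab: "0 < b" "b < 1" "1 < a"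
    and specs: "spec K Xs L \<subseteq> {c. cmod c < b}" and specu: "spec K Xu L \<subseteq> {c. cmod c > a}"
    and \<nu>: "equivalent_norm K \<nu>" and ops: "opnorm_on \<nu> Xs L \<le> ennreal b"
    and opu: "opnorm_on \<nu> Xu (inv_into Xu L) \<le> ennreal (inverse a)"
    and max: "\<And>xu xs. xu \<in> Xu \<Longrightarrow> xs \<in> Xs \<Longrightarrow> \<nu> (xu + xs) = max (\<nu> xu) (\<nu> xs)"
    using split unfolding hyperbolic_splitting_def Let_def Xs_def Xu_def by auto
  have lin: "linear L"
    using L by (cases K) (auto simp: bounded_linear.linear)
  have minus_u: "- y \<in> Xu" if y: "y \<in> Xu" for y
  proof -
    obtain z where "y = proj_u K L z"
      using y unfolding Xu_def by blast
    then have "- y = proj_u K L (- z)"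
      by (simp add: proj_u_def proj_s_minus[OF K L circle])
    then show ?thesis by (simp add: Xu_def)
  qed
  have bijs: "bij_betw (\<lambda>x. 1 *\<^sub>R x - L x) Xs Xs" and biju: "bij_betw (\<lambda>x. 1 *\<^sub>R x - L x) Xu Xu"
    and biju0: "bij_betw (\<lambda>x. 0 *\<^sub>R x - L x) Xu Xu"
  proof -
    have "complex_of_real 1 \<notin> spec K Xs L" "complex_of_real 1 \<notin> spec K Xu L"
        "complex_of_real 0 \<notin> spec K Xu L"
      using specs specu ab by auto
    from this[THEN bij_betw_if_real_not_in_spec] show
      "bij_betw (\<lambda>x. 1 *\<^sub>R x - L x) Xs Xs" "bij_betw (\<lambda>x. 1 *\<^sub>R x - L x) Xu Xu"
      "bij_betw (\<lambda>x. 0 *\<^sub>R x - L x) Xu Xu"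
      by auto
  qed
  have s: "(1 - b) * \<nu> y \<le> \<nu> (y - L y)" if "y \<in> Xs" for y
    using opnorm_on_leD[OF \<nu> ops that] ab linear_0[OF lin]
      equivalent_norm_diff_triangle[OF \<nu>, of y "L y"] by (simp add: algebra_simps)
  have u: "(a - 1) * \<nu> y \<le> \<nu> (y - L y)" if y: "y \<in> Xu" for y
  proof -
    have inj: "inj_on L Xu"
      using biju0 by (auto simp: bij_betw_def inj_on_def)
    \<comment> \<open>Since \<open>0\<close> avoids the spectrum, \<open>- L\<close> preserves \<open>Xu\<close>; symmetry of \<open>Xu\<close> removes the sign.\<close>
    have "- L y \<in> Xu"
      using biju0 y by (auto simp: bij_betw_def)
    then have Ly: "L y \<in> Xu" using minus_u by fastforce
    have "\<nu> (inv_into Xu L (L y)) \<le> inverse a * \<nu> (L y)"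
    proof (rule opnorm_on_leD[OF \<nu> opu Ly])
      \<comment> \<open>The convention \<open>0 / 0 = 0\<close> hides the image of the vector \<open>0\<close> from the operator norm. If
        \<open>L y = 0\<close> then also \<open>L (- y) = 0\<close>, and injectivity gives \<open>y = 0\<close>.\<close>
      show "inv_into Xu L (L y) = 0" if "L y = 0"
      proof -
        have "- y = y"
          using inj y minus_u[OF y] that by (auto simp: inj_on_def linear_neg[OF lin])
        then have "2 *\<^sub>R y = 0" by (metis add.right_inverse scaleR_2)
        then have "y = 0" by simp
        with inv_into_f_f[OF inj y] show ?thesis by metis
      qed
    qed (use ab in simp)
    then have "a * \<nu> y \<le> \<nu> (L y)"
      using ab inj y by (simp add: field_simps)
    then show ?thesis
      using equivalent_norm_diff_triangle[OF \<nu>, of "L y" y]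
        equivalent_norm_minus_commute[OF \<nu>, of "L y" y] by (simp add: algebra_simps)
  qed
  define xs where "xs = proj_s K L x"
  define xu where "xu = proj_u K L x"
  have mem: "xs \<in> Xs" "xu \<in> Xu" by (auto simp: xs_def xu_def Xs_def Xu_def)
  have x: "x = xu + xs" by (simp add: xs_def xu_def proj_u_def)
  have "x - L x = (xu - L xu) + (xs - L xs)"
    by (simp add: x linear_add[OF lin])
  moreover have "xu - L xu \<in> Xu" "xs - L xs \<in> Xs"
    using bijs biju mem by (auto simp: bij_betw_def)
  ultimately have "\<nu> (x - L x) = max (\<nu> (xu - L xu)) (\<nu> (xs - L xs))"
    by (simp add: max)
  moreover have "\<nu> x = max (\<nu> xu) (\<nu> xs)"
    using max[OF mem(2,1)] by (simp add: x)
  moreover have "min (1 - b) (a - 1) * \<nu> xs \<le> \<nu> (xs - L xs)"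
    by (rule order_trans[OF _ s[OF mem(1)]])
       (simp add: mult_right_mono equivalent_norm_nonneg[OF \<nu>])
  moreover have "min (1 - b) (a - 1) * \<nu> xu \<le> \<nu> (xu - L xu)"
    by (rule order_trans[OF _ u[OF mem(2)]])
       (simp add: mult_right_mono equivalent_norm_nonneg[OF \<nu>])
  ultimately show ?thesis
    by (smt (verit) max_def)
qed

section \<open>Fixed points near a weakly hyperbolic point\<close>

text \<open>
  The neighbourhood \<open>B\<close> and the tolerance \<open>\<epsilon>\<close> depend on \<open>T\<close>, \<open>p\<close> and \<open>W\<close> but not on the perturbed
  map \<open>S\<close>. Arbitrary \<open>W\<close> makes it possible to keep the neighbourhoods of different equilibria
  disjoint.
\<close>

lemma weakly_hyperbolic_persists:
  fixes K :: "'a::banach scalars"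
  assumes K: "banach_scalars K" and hyp: "weakly_hyperbolic K T p"
    and W: "open W" "p \<in> W"
  obtains B \<epsilon> where "p \<in> interior B" "B \<subseteq> W" "0 < \<epsilon>"
    and "\<And>S. (\<forall>x\<in>W. norm (S x - T x) \<le> \<epsilon>) \<Longrightarrow>
        (\<forall>x\<in>W. \<forall>y\<in>W. norm ((S x - T x) - (S y - T y)) \<le> \<epsilon> * norm (x - y)) \<Longrightarrow>
        \<exists>!x. x \<in> B \<and> S x = x"
proof -
  obtain L N a b \<nu> U \<gamma> where
        TLN: "\<And>x. T (x + p) - p = L x + N x"
    and split: "hyperbolic_splitting K L a b \<nu>"
    and U: "0 \<in> interior U" and \<gamma>: "0 < \<gamma>" "b + 2 * \<gamma> < 1" "1 < a - 2 * \<gamma>"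
    and N: "\<And>x y. x \<in> U \<Longrightarrow> y \<in> U \<Longrightarrow> \<nu> (N x - N y) \<le> \<gamma> * \<nu> (x - y)"
    and p: "T p = p"
    using hyp unfolding weakly_hyperbolic_def equilibria_def by blast
  have \<nu>: "equivalent_norm K \<nu>" and L: "bounded_operator K L"
    and circle: "spec K UNIV L \<inter> {c. cmod c = 1} = {}"
    using split unfolding hyperbolic_splitting_def Let_def by auto
  have lin: "linear L"
    using L by (cases K) (auto simp: bounded_linear.linear)
  define m where "m = min (1 - b) (a - 1)"
  have m: "2 * \<gamma> < m" using \<gamma> by (simp add: m_def)
  have below: "m * \<nu> x \<le> \<nu> (x - L x)" for x
    unfolding m_def by (rule hyperbolic_splitting_bounded_below[OF K split])
  have "complex_of_real 1 \<notin> spec K UNIV L" using circle by auto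
  from bij_betw_if_real_not_in_spec[OF this] have bij: "bij (\<lambda>x. x - L x)" by simp
  define Q where "Q = inv (\<lambda>x. x - L x)"
  have Q_iff: "Q y = x \<longleftrightarrow> x - L x = y" for x y
    unfolding Q_def using bij_inv_eq_iff[OF bij, of x y] by auto
  have Q: "Q y - L (Q y) = y" for y
    using Q_iff[of y "Q y"] by simp
  have Q_diff: "\<nu> (Q y - Q z) \<le> \<nu> (y - z) / m" for y z
  proof -
    have "(Q y - Q z) - L (Q y - Q z) = (Q y - L (Q y)) - (Q z - L (Q z))"
      by (simp add: linear_diff[OF lin])
    then have "m * \<nu> (Q y - Q z) \<le> \<nu> (y - z)"
      using below[of "Q y - Q z"] by (simp only: Q)
    then show ?thesis
      using m \<gamma> by (simp add: field_simps)
  qed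
  have N0: "N 0 = 0" using TLN[of 0] p by (simp add: linear_0[OF lin])
  obtain c C where c: "0 < c" "\<And>x. c * norm x \<le> \<nu> x" and C: "0 < C" "\<And>x. \<nu> x \<le> C * norm x"
    using equivalent_norm_bounds[OF \<nu>] by metis
  obtain d where d: "0 < d" "ball 0 d \<subseteq> U" "ball p d \<subseteq> W"
  proof -
    obtain d1 d2 where "0 < d1" "ball 0 d1 \<subseteq> U" "0 < d2" "ball p d2 \<subseteq> W"
      using U W by (meson mem_interior openE)
    then show thesis by (intro that[of "min d1 d2"]) auto
  qed
  define r where "r = c * d / 2"
  have r: "0 < r" using c d by (simp add: r_def)
  have small: "h \<in> U" "p + h \<in> W" if "\<nu> h \<le> r" for h
  proof -
    have "0 < c * d" using c(1) d(1) by simp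
    then have "c * norm h < c * d"
      using c(2)[of h] that unfolding r_def by linarith
    then have "norm h < d" using c(1) by simp
    then show "h \<in> U" "p + h \<in> W" using d(2,3) by (auto simp: subset_iff dist_norm)
  qed
  \<comment> \<open>The first bound lets \<open>R\<close> contribute at most \<open>1/4\<close> to the Lipschitz constant of \<open>G\<close> below, on top
    of the \<open>1/2\<close> from \<open>N\<close>; the second keeps \<open>\<nu> (G 0)\<close> below \<open>(1 - 3/4) * r\<close>.\<close>
  define \<epsilon> where "\<epsilon> = min (c * m / (4 * C)) (m * r / (4 * C))"
  have \<epsilon>: "0 < \<epsilon>" "C * \<epsilon> / c \<le> m / 4" "C * \<epsilon> / m \<le> r / 4"
    using c(1) C(1) m \<gamma> r by (auto simp: \<epsilon>_def field_simps min_def)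
  define B where "B = {x. \<nu> (x - p) \<le> r}"
  show thesis
  proof (rule that[of B \<epsilon>])
    have "ball p (r / C) \<subseteq> B"
    proof
      fix x assume "x \<in> ball p (r / C)"
      then have "C * norm (x - p) \<le> r" using C by (simp add: dist_norm norm_minus_commute field_simps)
      then show "x \<in> B" using C(2)[of "x - p"] by (simp add: B_def)
    qed
    then show "p \<in> interior B" using r C(1) by (meson divide_pos_pos mem_interior)
    show "B \<subseteq> W" using small(2) by (force simp: B_def)
    show "0 < \<epsilon>" by (rule \<epsilon>)
    fix S
    assume sup: "\<forall>x\<in>W. norm (S x - T x) \<le> \<epsilon>"
      and lip: "\<forall>x\<in>W. \<forall>y\<in>W. norm ((S x - T x) - (S y - T y)) \<le> \<epsilon> * norm (x - y)"
    define R where "R h = S (p + h) - T (p + h)" for h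
    define G where "G h = Q (N h + R h)" for h
    have fixed_iff: "S (p + h) = p + h \<longleftrightarrow> G h = h" for h
      using TLN[of h] by (auto simp: G_def Q_iff R_def algebra_simps)
    have "\<exists>!h. \<nu> h \<le> r \<and> G h = h"
    proof (rule contraction_on_equivalent_norm_ball[OF \<nu>, of "3/4"])
      fix h k assume h: "\<nu> h \<le> r" and k: "\<nu> k \<le> r"
      have "\<nu> (R h - R k) \<le> C * norm (R h - R k)" by (rule C)
      also have "\<dots> \<le> C * (\<epsilon> * norm (h - k))"
        using lip small(2)[OF h] small(2)[OF k] C(1) unfolding R_def
        by (intro mult_left_mono) fastforce+
      also have "\<dots> = C * \<epsilon> / c * (c * norm (h - k))" using c by simp
      also have "\<dots> \<le> m / 4 * \<nu> (h - k)"
        using \<epsilon> c C m \<gamma> by (intro mult_mono) auto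
      finally have R: "\<nu> (R h - R k) \<le> m / 4 * \<nu> (h - k)" .
      have "\<nu> (N h - N k) \<le> \<gamma> * \<nu> (h - k)" using small h k by (intro N)
      also have "\<dots> \<le> m / 2 * \<nu> (h - k)"
        using m equivalent_norm_nonneg[OF \<nu>] by (intro mult_right_mono) auto
      finally have NR: "\<nu> ((N h - N k) + (R h - R k)) \<le> 3 * m / 4 * \<nu> (h - k)"
        using equivalent_norm_triangle[OF \<nu>, of "N h - N k" "R h - R k"] R by (simp add: algebra_simps)
      have "\<nu> (G h - G k) \<le> \<nu> ((N h - N k) + (R h - R k)) / m"
        using Q_diff[of "N h + R h" "N k + R k"] by (simp add: G_def algebra_simps)
      also have "\<dots> \<le> 3 * m / 4 * \<nu> (h - k) / m"
        using NR m \<gamma> by (intro divide_right_mono) auto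
      finally show "\<nu> (G h - G k) \<le> 3 / 4 * \<nu> (h - k)" using m \<gamma> by simp
    next
      have "Q 0 = 0" by (simp add: Q_iff linear_0[OF lin])
      then have "\<nu> (G 0) \<le> \<nu> (R 0) / m"
        using Q_diff[of "R 0" 0] by (simp add: G_def N0)
      also have "\<dots> \<le> C * norm (R 0) / m"
        using C m \<gamma> by (intro divide_right_mono) auto
      also have "\<dots> \<le> C * \<epsilon> / m"
        using sup W C m \<gamma> by (intro divide_right_mono mult_left_mono) (auto simp: R_def)
      also have "\<dots> \<le> r / 4" by (rule \<epsilon>(3))
      finally show "\<nu> (G 0) \<le> (1 - 3 / 4) * r" by simp
    qed (use r in auto)
    then obtain h where h: "\<nu> h \<le> r" "G h = h" and uniq: "\<And>k. \<nu> k \<le> r \<Longrightarrow> G k = k \<Longrightarrow> k = h"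
      by blast
    show "\<exists>!x. x \<in> B \<and> S x = x"
    proof (rule ex1I[of _ "p + h"])
      show "p + h \<in> B \<and> S (p + h) = p + h" using h fixed_iff by (simp add: B_def)
      show "x = p + h" if "x \<in> B \<and> S x = x" for x
        using that uniq[of "x - p"] fixed_iff[of "x - p"] by (auto simp: B_def algebra_simps)
    qed
  qed
qed

section \<open>Counting the fixed points of nearby maps\<close>

lemma triple_norm_on_leD:
  assumes "triple_norm_on V D \<le> ennreal \<epsilon>" "0 \<le> \<epsilon>" "x \<in> V"
  shows "norm (D x) \<le> \<epsilon>" "y \<in> V \<Longrightarrow> norm (D x - D y) \<le> \<epsilon> * norm (x - y)"
proof -
  have "sup_norm_on V D \<le> ennreal \<epsilon>" and lip: "lip_norm_on V D \<le> ennreal \<epsilon>"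
    using assms(1) by (auto simp: triple_norm_on_def)
  then have "ennreal (norm (D x)) \<le> ennreal \<epsilon>"
    using assms(3) unfolding sup_norm_on_def by (meson SUP_upper order_trans)
  then show "norm (D x) \<le> \<epsilon>" using assms(2) by (simp add: ennreal_le_iff)
  assume "y \<in> V"
  show "norm (D x - D y) \<le> \<epsilon> * norm (x - y)"
  proof (cases "x = y")
    case False
    then have "ennreal (norm (D x - D y) / norm (x - y)) \<le> lip_norm_on V D"
      unfolding lip_norm_on_def using assms(3) \<open>y \<in> V\<close> by (intro SUP_upper2[of "(x, y)"]) auto
    then have "ennreal (norm (D x - D y) / norm (x - y)) \<le> ennreal \<epsilon>"
      using lip by order
    then have "norm (D x - D y) / norm (x - y) \<le> \<epsilon>"
      using assms(2) by (simp add: ennreal_le_iff)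
    then show ?thesis using False by (simp add: field_simps)
  qed simp
qed

lemma no_fixed_points_away:
  fixes T :: "'a::banach \<Rightarrow> 'a"
  assumes T: "continuous_on UNIV T" and C: "compact C" and free: "\<And>x. x \<in> C \<Longrightarrow> T x \<noteq> x"
  shows "\<exists>\<delta>>0. \<forall>x\<in>C. \<delta> \<le> norm (x - T x)"
proof (cases "C = {}")
  case False
  have "continuous_on C (\<lambda>x. norm (x - T x))"
    using continuous_on_subset[OF T] by (intro continuous_intros) auto
  then obtain z where z: "z \<in> C" "\<forall>x\<in>C. norm (z - T z) \<le> norm (x - T x)"
    using continuous_attains_inf[OF C False] by blast
  have "0 < norm (z - T z)" using free[OF z(1)] by simp
  then show ?thesis using z(2) by blast
qed (auto intro: exI[of _ 1])

lemma card_eq_if_unique_in_disjoint: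
  assumes P: "finite P" and disj: "disjoint_family_on B P"
    and uniq: "\<And>p. p \<in> P \<Longrightarrow> \<exists>!x. x \<in> B p \<and> x \<in> E" and cover: "E \<subseteq> (\<Union>p\<in>P. B p)"
  shows "finite E \<and> card E = card P"
proof -
  have "\<forall>p\<in>P. \<exists>x. x \<in> B p \<and> x \<in> E" using uniq by blast
  then obtain f where f: "\<And>p. p \<in> P \<Longrightarrow> f p \<in> B p \<and> f p \<in> E" by metis
  have "inj_on f P"
    using f disj by (intro inj_onI) (metis disjoint_family_onD disjoint_iff)
  moreover have "f ` P = E"
  proof
    show "E \<subseteq> f ` P"
    proof
      fix x assume x: "x \<in> E"
      then obtain p where p: "p \<in> P" "x \<in> B p" using cover by blast
      then have "x = f p" using uniq[OF p(1)] f[OF p(1)] x by blast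
      then show "x \<in> f ` P" using p(1) by blast
    qed
  qed (use f in auto)
  ultimately show ?thesis using P by (metis card_image finite_imageI)
qed

theorem theorem4p5:
  fixes K :: "'a::banach scalars"
    and T :: "real \<Rightarrow> 'a \<Rightarrow> 'a"
    and V :: "'a set"
  assumes "banach_scalars K"
    and "\<And>\<eta>. \<eta> \<in> {0..1} \<Longrightarrow> continuous_on UNIV (T \<eta>)"
    and "\<And>x. x \<in> equilibria (T 0) \<Longrightarrow> weakly_hyperbolic K (T 0) x"
    and "finite (equilibria (T 0))"
    and "compact (closure (\<Union>\<eta>\<in>{0..1}. equilibria (T \<eta>)))"
    and "closure (\<Union>\<eta>\<in>{0..1}. equilibria (T \<eta>)) \<subseteq> interior V"
    and "((\<lambda>\<eta>. triple_norm_on V (\<lambda>x. T \<eta> x - T 0 x)) \<longlongrightarrow> 0) (at_right 0)"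
  shows "\<exists>\<eta>0. 0 < \<eta>0 \<and> \<eta>0 \<le> 1 \<and>
           (\<forall>\<eta>. 0 \<le> \<eta> \<and> \<eta> \<le> \<eta>0 \<longrightarrow>
              finite (equilibria (T \<eta>)) \<and> card (equilibria (T \<eta>)) = card (equilibria (T 0)))"
proof -
  define P where "P = equilibria (T 0)"
  define Z where "Z = closure (\<Union>\<eta>\<in>{0..1}. equilibria (T \<eta>))"
  have in_Z: "x \<in> Z" if "0 \<le> \<eta>" "\<eta> \<le> 1" "T \<eta> x = x" for \<eta> x
    using that closure_subset unfolding Z_def by (fastforce simp: equilibria_def)
  have ZV: "Z \<subseteq> interior V" using assms(6) by (simp add: Z_def)
  have finP: "finite P" using assms(4) by (simp add: P_def)
  obtain s where s: "0 < s" "\<And>p q. p \<in> P \<Longrightarrow> q \<in> P \<Longrightarrow> p \<noteq> q \<Longrightarrow> s \<le> dist p q"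
  proof -
    have "\<exists>d>0. \<forall>q\<in>P. q \<noteq> p \<longrightarrow> d \<le> dist p q" for p
      using finite_set_avoid[OF finP] by blast
    then obtain d where d: "\<And>p. 0 < d p" "\<And>p q. q \<in> P \<Longrightarrow> q \<noteq> p \<Longrightarrow> d p \<le> dist p q" by metis
    show thesis
    proof (rule that[of "Min (insert 1 (d ` P))"])
      show "0 < Min (insert 1 (d ` P))" using finP d(1) by simp
      show "Min (insert 1 (d ` P)) \<le> dist p q" if "p \<in> P" "q \<in> P" "p \<noteq> q" for p q
        using that d(2)[of q p] finP by (intro order_trans[OF Min_le]) auto
    qed
  qed
  define W where "W p = interior V \<inter> ball p (s / 2)" for p
  define isolates where "isolates p B \<epsilon> \<longleftrightarrow> p \<in> interior B \<and> B \<subseteq> W p \<and> 0 < \<epsilon> \<and>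
      (\<forall>S. (\<forall>x\<in>W p. norm (S x - T 0 x) \<le> \<epsilon>) \<longrightarrow>
        (\<forall>x\<in>W p. \<forall>y\<in>W p. norm ((S x - T 0 x) - (S y - T 0 y)) \<le> \<epsilon> * norm (x - y)) \<longrightarrow>
        (\<exists>!x. x \<in> B \<and> S x = x))" for p B and \<epsilon> :: real
  have "\<exists>B \<epsilon>. isolates p B \<epsilon>" if p: "p \<in> P" for p
  proof -
    have hyp: "weakly_hyperbolic K (T 0) p" using assms(3) p by (simp add: P_def)
    have "p \<in> Z" using in_Z[of 0 p] p by (simp add: P_def equilibria_def)
    then have W: "open (W p)" "p \<in> W p" using ZV s(1) by (auto simp: W_def)
    show ?thesis
    proof (rule weakly_hyperbolic_persists[OF assms(1) hyp W])
      show ?thesis if "p \<in> interior B" "B \<subseteq> W p" "0 < \<epsilon>"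
        and "\<And>S. \<forall>x\<in>W p. norm (S x - T 0 x) \<le> \<epsilon> \<Longrightarrow>
          \<forall>x\<in>W p. \<forall>y\<in>W p. norm ((S x - T 0 x) - (S y - T 0 y)) \<le> \<epsilon> * norm (x - y) \<Longrightarrow>
          \<exists>!x. x \<in> B \<and> S x = x" for B \<epsilon>
        unfolding isolates_def
        by (intro exI[of _ B] exI[of _ \<epsilon>] conjI allI impI) (fact that)+
    qed
  qed
  then obtain B \<epsilon> where iso: "\<And>p. p \<in> P \<Longrightarrow> isolates p (B p) (\<epsilon> p)"
    by metis
  have B: "p \<in> interior (B p)" "B p \<subseteq> W p" and \<epsilon>: "0 < \<epsilon> p" if "p \<in> P" for p
    using iso[OF that] by (simp_all add: isolates_def)
  have uniq: "\<exists>!x. x \<in> B p \<and> S x = x" if "p \<in> P" "\<forall>x\<in>W p. norm (S x - T 0 x) \<le> \<epsilon> p"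
      "\<forall>x\<in>W p. \<forall>y\<in>W p. norm ((S x - T 0 x) - (S y - T 0 y)) \<le> \<epsilon> p * norm (x - y)" for p S
    using iso[OF that(1)] that(2,3) unfolding isolates_def by blast
  have disj: "disjoint_family_on B P"
  proof (unfold disjoint_family_on_def, intro ballI impI)
    fix p q assume pq: "p \<in> P" "q \<in> P" "p \<noteq> q"
    have "ball p (s / 2) \<inter> ball q (s / 2) = {}"
      using s(2)[OF pq] by (intro disjoint_ballI) simp
    then show "B p \<inter> B q = {}" using B(2)[OF pq(1)] B(2)[OF pq(2)] unfolding W_def by blast
  qed
  have comp: "compact (Z - (\<Union>p\<in>P. interior (B p)))"
    using assms(5) by (intro compact_diff) (auto simp: Z_def)
  have free: "T 0 x \<noteq> x" if "x \<in> Z - (\<Union>p\<in>P. interior (B p))" for x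
    using that B(1) by (auto simp: P_def equilibria_def)
  have cont: "continuous_on UNIV (T 0)" by (rule assms(2)) simp
  obtain \<delta> where \<delta>: "0 < \<delta>"
      "\<forall>x \<in> Z - (\<Union>p\<in>P. interior (B p)). \<delta> \<le> norm (x - T 0 x)"
    using no_fixed_points_away[OF cont comp free] by blast
  define e where "e = Min (insert (\<delta> / 2) (\<epsilon> ` P))"
  have e: "0 < e" "e < \<delta>" "\<And>p. p \<in> P \<Longrightarrow> e \<le> \<epsilon> p"
    unfolding e_def using finP \<delta>(1) \<epsilon> by (auto simp: Min_less_iff)
  have "\<forall>\<^sub>F \<eta> in at_right 0. triple_norm_on V (\<lambda>x. T \<eta> x - T 0 x) < ennreal e"
    using assms(7) e(1) by (intro order_tendstoD(2)) auto
  then obtain \<beta> where \<beta>: "0 < \<beta>"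
      "\<And>\<eta>. 0 < \<eta> \<Longrightarrow> \<eta> < \<beta> \<Longrightarrow> triple_norm_on V (\<lambda>x. T \<eta> x - T 0 x) < ennreal e"
    by (auto simp: eventually_at_right_field)
  show ?thesis
  proof (intro exI[of _ "min 1 (\<beta> / 2)"] conjI allI impI)
    fix \<eta> assume \<eta>: "0 \<le> \<eta> \<and> \<eta> \<le> min 1 (\<beta> / 2)"
    have "finite (equilibria (T \<eta>)) \<and> card (equilibria (T \<eta>)) = card P"
    proof (cases "\<eta> = 0")
      case True
      then show ?thesis using finP by (simp add: P_def)
    next
      case False
      then have "triple_norm_on V (\<lambda>x. T \<eta> x - T 0 x) \<le> ennreal e"
        using \<beta> \<eta> by (intro less_imp_le) auto
      note close = triple_norm_on_leD[OF this less_imp_le[OF e(1)]]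
      show ?thesis
      proof (rule card_eq_if_unique_in_disjoint[OF finP disj])
        fix p assume p: "p \<in> P"
        have WV: "x \<in> V" if "x \<in> W p" for x
          using that interior_subset by (auto simp: W_def)
        have "norm (T \<eta> x - T 0 x) \<le> \<epsilon> p" if "x \<in> W p" for x
          using close(1)[OF WV[OF that]] e(3)[OF p] by linarith
        moreover have "norm ((T \<eta> x - T 0 x) - (T \<eta> y - T 0 y)) \<le> \<epsilon> p * norm (x - y)"
          if "x \<in> W p" "y \<in> W p" for x y
          by (rule order_trans[OF close(2)[OF WV WV]]) (use that e(3)[OF p] in \<open>auto intro: mult_right_mono\<close>)
        ultimately show "\<exists>!x. x \<in> B p \<and> x \<in> equilibria (T \<eta>)"
          using uniq[OF p, of "T \<eta>"] by (simp add: equilibria_def)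
      next
        show "equilibria (T \<eta>) \<subseteq> (\<Union>p\<in>P. B p)"
        proof
          fix x assume "x \<in> equilibria (T \<eta>)"
          then have fixed: "T \<eta> x = x" by (simp add: equilibria_def)
          then have Z: "x \<in> Z" using in_Z[of \<eta> x] \<eta> by simp
          then have "x \<in> V" using ZV interior_subset by blast
          then have "norm (x - T 0 x) \<le> e" using close(1)[of x] fixed by simp
          then have "norm (x - T 0 x) < \<delta>" using e(2) by linarith
          then have "x \<in> (\<Union>p\<in>P. interior (B p))" using \<delta>(2) Z by force
          then show "x \<in> (\<Union>p\<in>P. B p)" using interior_subset by blast
        qed
      qed
    qed
    then show "finite (equilibria (T \<eta>))" "card (equilibria (T \<eta>)) = card (equilibria (T 0))"
      by (auto simp: P_def)
  qed (use \<beta>(1) in auto)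
qed

end
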